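(* Let $n\ge 2$, let $F=GF(2^n)$ be the field with $2^n$ elements, and let $\vartheta$ be the Frobenius automorphism of $F$, i.e. $\vartheta(x)=x^2$ for all $x\in F$. Let $$A(n,\vartheta)=\left\{U(a,b)=\begin{bmatrix}1&0&0\\ a&1&0\\ b&\vartheta(a)&1\end{bmatrix} : a,b\in F\right\},$$ a group under matrix multiplication, which is given by $U(a,b)U(a',b')=U(a+a',\,b+b'+a'\vartheta(a))$. Then the spectrum of its commuting graph is $$\operatorname{Spec}(\Gamma_{A(n,\vartheta)})=\left\{(-1)^{(2^n-1)^2},\ (2^n-1)^{2^n-1}\right\}.$$
   Context: For a finite non-abelian group $G$ with centre $Z(G)$, the commuting graph $\Gamma_G$ is the simple undirected graph with vertex set $G\setminus Z(G)$ in which two distinct vertices $x,y$ are adjacent if and only if $xy=yx$. The spectrum $\operatorname{Spec}$ of a graph is the multiset of eigenvalues of its adjacency matrix, written $\{\lambda_1^{k_1},\dots,\lambda_r^{k_r}\}$, where $\lambda^{k}$ denotes that $\lambda$ is listed $k$ times. *)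

theory Defs
  imports
    "HOL-Library.Cardinality"
    "HOL-Algebra.Group"
    "Graph_Theory.Pair_Digraph"
    "Jordan_Normal_Form.Char_Poly"
begin

definition centre :: "('a, 'b) monoid_scheme \<Rightarrow> 'a set" where
  "centre G = {z \<in> carrier G. \<forall>g \<in> carrier G. z \<otimes>\<^bsub>G\<^esub> g = g \<otimes>\<^bsub>G\<^esub> z}"

text \<open>
  Simple undirected graphs are represented as in the entry \<open>Graph_Theory\<close>
  (locale \<open>pair_graph\<close>): each edge contributes both of its orientations as arcs.
\<close>

definition commuting_graph :: "('a, 'b) monoid_scheme \<Rightarrow> 'a pair_pre_digraph" where
  "commuting_graph G =
     \<lparr> pverts = carrier G - centre G,
       parcs = {(x, y). x \<in> carrier G - centre G \<and> y \<in> carrier G - centre G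
                  \<and> x \<noteq> y \<and> x \<otimes>\<^bsub>G\<^esub> y = y \<otimes>\<^bsub>G\<^esub> x} \<rparr>"

lemma pair_graph_commuting_graph:
  assumes "finite (carrier G)"
  shows "pair_graph (commuting_graph G)"
proof -
  have "parcs (commuting_graph G) \<subseteq> carrier G \<times> carrier G"
    by (auto simp: commuting_graph_def)
  then have "finite (parcs (commuting_graph G))"
    using assms by (meson finite_SigmaI finite_subset)
  then show ?thesis
    using assms
    by unfold_locales
      (auto simp: commuting_graph_def symmetric_def arcs_ends_conv intro!: symI)
qed

text \<open>The adjacency matrix with respect to an enumeration \<open>vs\<close> of the vertices.\<close>

definition adjacency_mat :: "'a pair_pre_digraph \<Rightarrow> 'a list \<Rightarrow> complex mat" where
  "adjacency_mat G vs =
     mat (length vs) (length vs) (\<lambda>(i, j). if (vs ! i, vs ! j) \<in> parcs G then 1 else 0)"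

text \<open>
  The eigenvalues counted with algebraic multiplicity, i.e. the multiset of roots of the
  characteristic polynomial. The enumeration of the vertices is immaterial, see
  \<open>graph_spectrum_eq\<close> below. Only meaningful for finite graphs.
\<close>

definition graph_spectrum :: "'a pair_pre_digraph \<Rightarrow> complex multiset" where
  "graph_spectrum G =
     proots (char_poly (adjacency_mat G (SOME vs. distinct vs \<and> set vs = pverts G)))"

lemma char_poly_permute:
  assumes A: "A \<in> carrier_mat n n" and p: "p permutes {0..<n}"
  shows "char_poly (mat n n (\<lambda>(i, j). A $$ (p i, p j))) = char_poly (A :: complex mat)"
proof -
  let ?C = "char_poly_matrix A"
  let ?R = "mat n n (\<lambda>(i, j). ?C $$ (p i, j))"
  let ?D = "mat n n (\<lambda>(i, j). transpose_mat ?R $$ (p i, j))"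
  have C: "?C \<in> carrier_mat n n" using A by simp
  have lt: "p i < n" if "i < n" for i
    using permutes_in_image[OF p, of i] that by simp
  have inj: "p i = p j \<longleftrightarrow> i = j" for i j
    using permutes_inj[OF p] by (simp add: inj_eq)
  have R: "?R \<in> carrier_mat n n" by simp
  have "det ?D = signof p * det (transpose_mat ?R)"
    by (rule det_permute_rows) (use p in auto)
  also have "\<dots> = signof p * det ?R"
    by (simp add: det_transpose[OF R])
  also have "\<dots> = signof p * (signof p * det ?C)"
    using det_permute_rows[OF C p] by simp
  also have "\<dots> = det ?C"
    by (simp add: sign_def)
  finally have D: "det ?D = det ?C" .
  have "char_poly_matrix (mat n n (\<lambda>(i, j). A $$ (p i, p j))) = transpose_mat ?D"
    by (rule eq_matI) (use A lt inj in \<open>auto simp: char_poly_matrix_def\<close>)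
  then have "det (char_poly_matrix (mat n n (\<lambda>(i, j). A $$ (p i, p j)))) = det ?D"
    by (simp add: det_transpose[of ?D n])
  with D show ?thesis by (simp add: char_poly_def)
qed

lemma graph_spectrum_eq:
  assumes "distinct vs" and "set vs = pverts G"
  shows "graph_spectrum G = proots (char_poly (adjacency_mat G vs))"
proof -
  define ws where "ws = (SOME vs. distinct vs \<and> set vs = pverts G)"
  have ws: "distinct ws" "set ws = pverts G"
    using someI[of "\<lambda>vs. distinct vs \<and> set vs = pverts G" vs] assms
    by (auto simp: ws_def)
  have "mset ws = mset vs"
    using ws assms by (simp flip: set_eq_iff_mset_eq_distinct)
  then obtain p where p: "p permutes {..<length vs}" "permute_list p vs = ws"
    by (rule mset_eq_permutation)
  have len: "length ws = length vs" using p by auto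
  let ?n = "length vs"
  have lt: "p i < ?n" if "i < ?n" for i
    using permutes_in_image[OF p(1), of i] that by simp
  have "adjacency_mat G ws = mat ?n ?n (\<lambda>(i, j). adjacency_mat G vs $$ (p i, p j))"
    by (rule eq_matI)
      (use lt in \<open>auto simp: adjacency_mat_def len p(2)[symmetric] permute_list_nth[OF p(1)]\<close>)
  moreover have "adjacency_mat G vs \<in> carrier_mat ?n ?n"
    by (simp add: adjacency_mat_def)
  ultimately have "char_poly (adjacency_mat G ws) = char_poly (adjacency_mat G vs)"
    using char_poly_permute[of "adjacency_mat G vs" ?n p] p(1)
    by (simp add: lessThan_atLeast0)
  then show ?thesis
    by (simp add: graph_spectrum_def flip: ws_def)
qed

definition frobenius :: "'f :: field \<Rightarrow> 'f" where
  "frobenius x = x ^ 2"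

definition U_mat :: "('f :: field \<Rightarrow> 'f) \<Rightarrow> 'f \<Rightarrow> 'f \<Rightarrow> 'f mat" where
  "U_mat \<theta> a b = mat_of_rows_list 3
     [[1, 0, 0],
      [a, 1, 0],
      [b, \<theta> a, 1]]"

text \<open>
  The group \<open>A(n, \<theta>)\<close>; the parameter \<open>n\<close> is determined by the field \<open>'f\<close>, which has
  \<open>2 ^ n\<close> elements.
\<close>

definition A_group :: "('f :: field \<Rightarrow> 'f) \<Rightarrow> 'f mat monoid" where
  "A_group \<theta> = \<lparr> carrier = {U_mat \<theta> a b | a b. True}, mult = (*), one = 1\<^sub>m 3 \<rparr>"

end

theory Submission
  imports Defs "HOL-Number_Theory.Residues"
begin

text \<open>
  In characteristic 2, the elements \<open>U(a, b)\<close> and \<open>U(a', b')\<close> commute iff \<open>a' a\<^sup>2 = a a'\<^sup>2\<close>,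
  i.e. iff \<open>a = 0\<close>, \<open>a' = 0\<close> or \<open>a = a'\<close>. Since the field has two distinct nonzero elements,
  the centre consists of the \<open>U(0, b)\<close>, so the commuting graph is the disjoint union, over
  \<open>a \<noteq> 0\<close>, of the complete graphs on \<open>{U(a, b) | b}\<close>. The spectrum of a disjoint union of
  complete graphs is found by conjugating its adjacency matrix to triangular form.
\<close>

section \<open>Spectrum of a disjoint union of cliques of equal size\<close>

lemma proots_prod_list_linear:
  "proots (\<Prod>a\<leftarrow>as. [:- a, 1:]) = mset (as :: 'a :: idom list)"
proof (induction as)
  case (Cons a as)
  have "(\<Prod>a\<leftarrow>as. [:- a, 1:]) \<noteq> (0 :: 'a poly)"
    by (auto simp: prod_list_zero_iff)
  then show ?case
    using Cons by (simp add: proots_mult proots_linear_factor del: mult_pCons_left)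
qed auto

text \<open>Each block of \<open>q\<close> consecutive indices contains exactly one multiple of
  \<open>q\<close>, namely its first element. This counts the diagonal entries of the triangular
  matrix built below.\<close>

lemma mset_blocks:
  assumes "q > 0"
  shows "mset (map (\<lambda>i. if i mod q = 0 then x else y) [0..<m * q])
    = replicate_mset (m * (q - 1)) y + replicate_mset m x"
proof (induction m)
  case (Suc m)
  let ?f = "\<lambda>i. if i mod q = 0 then x else y"
  have "[0..<Suc m * q] = [0..<m * q] @ map (\<lambda>i. i + m * q) (0 # [1..<q])"
    using assms upt_add_eq_append[of 0 "m * q" q] by (simp add: map_add_upt add.commute flip: upt_conv_Cons)
  moreover have "map (?f \<circ> (\<lambda>i. i + m * q)) [1..<q] = map (\<lambda>_. y) [1..<q]"
    by (rule map_cong) auto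
  then have "mset (map (?f \<circ> (\<lambda>i. i + m * q)) [1..<q]) = replicate_mset (q - 1) y"
    by (simp add: map_replicate_const)
  ultimately have "mset (map ?f [0..<Suc m * q])
      = mset (map ?f [0..<m * q]) + add_mset x (replicate_mset (q - 1) y)"
    by (simp add: o_def)
  then show ?case
    unfolding Suc by (simp add: multiset_eq_iff)
qed simp

text \<open>\<open>A\<close> is block diagonal with \<open>m\<close> blocks J - I of size
  \<open>q\<close>, J being the all-ones matrix. Such a block maps the sum of its unit vectors to
  \<open>q - 1\<close> times itself, and any other unit vector to that sum minus the vector. This
  gives a triangular form whose diagonal carries the eigenvalues with multiplicity.\<close>

lemma proots_char_poly_cliques:
  fixes A :: "complex mat"
  assumes q: "q > 0"
    and A: "A = mat (m * q) (m * q) (\<lambda>(i, j). if i div q = j div q \<and> i \<noteq> j then 1 else 0)"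
  shows "proots (char_poly A)
    = replicate_mset (m * (q - 1)) (- 1) + replicate_mset m (of_nat q - 1)"
proof -
  let ?N = "m * q"
  define l where "l i = i div q * q" for i
  have l_le: "l i \<le> i" for i
    by (simp add: l_def)
  have less_l: "i < l i + q" for i
    using dividend_less_div_times[OF q, of i] by (simp add: l_def add.commute)
  have l_l [simp]: "l (l i) = l i" for i
    using q by (simp add: l_def)
  have l_eq: "l i = l j \<longleftrightarrow> i div q = j div q" for i j
    using q by (auto simp: l_def)
  have l_fix: "l i = i \<longleftrightarrow> i mod q = 0" for i
    by (metis add_cancel_left_right div_mult_mod_eq l_def)
  \<comment> \<open>\<open>l i\<close> is the first index in the block of \<open>i\<close>. In the basis obtained from the standard one by
    replacing the first unit vector of each block by the sum of the block (the columns of \<open>N 1\<close>),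
    the adjacency matrix becomes the upper triangular matrix \<open>T\<close>.\<close>
  define N :: "complex \<Rightarrow> complex mat" where
    "N c = mat ?N ?N (\<lambda>(i, j). (if i = j then 1 else 0) + (if l i \<noteq> i \<and> j = l i then c else 0))" for c
  define T :: "complex mat" where
    "T = mat ?N ?N (\<lambda>(i, j). if i = j then (if l i = i then of_nat q - 1 else - 1)
       else if l i = i \<and> l j = i then 1 else 0)"
  \<comment> \<open>\<open>M\<close> is the common value of \<open>N 1 * T\<close> and
    \<open>A * N 1\<close>; similarity is verified by computing through it entrywise.\<close>
  define M :: "complex mat" where
    "M = mat ?N ?N (\<lambda>(i, j). if j = l i then of_nat q - 1
       else (if l j = l i then 1 else 0) - (if i = j then 1 else 0))"
  have carrier: "A \<in> carrier_mat ?N ?N" "T \<in> carrier_mat ?N ?N" "N c \<in> carrier_mat ?N ?N" for c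
    by (auto simp: A T_def N_def)
  have N_left: "(N c * B) $$ (i, j) = B $$ (i, j) + (if l i \<noteq> i then c * B $$ (l i, j) else 0)"
    if "i < ?N" "j < ?N" "B \<in> carrier_mat ?N ?N" for B c i j
  proof -
    have "(N c * B) $$ (i, j) = (\<Sum>k<?N. (if i = k then B $$ (k, j) else 0)
        + (if k = l i then (if l i \<noteq> i then c * B $$ (k, j) else 0) else 0))"
      using that by (auto simp: N_def scalar_prod_def lessThan_atLeast0 algebra_simps intro!: sum.cong)
    then show ?thesis
      using that l_le[of i] by (simp add: sum.distrib)
  qed
  \<comment> \<open>\<open>N c\<close> is the identity plus \<open>c\<close> times a matrix of
    square zero: row \<open>i\<close> of that matrix points to \<open>l i\<close>, whose own row
    vanishes because \<open>l (l i) = l i\<close>.\<close>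
  have inv: "N c * N (- c) = 1\<^sub>m ?N" for c
  proof (rule eq_matI)
    fix i j assume "i < dim_row (1\<^sub>m ?N :: complex mat)" "j < dim_col (1\<^sub>m ?N :: complex mat)"
    then show "(N c * N (- c)) $$ (i, j) = 1\<^sub>m ?N $$ (i, j)"
      using l_le[of i] carrier by (subst N_left) (auto simp: N_def)
  qed (auto simp: N_def)
  have NT: "N 1 * T = M"
  proof (rule eq_matI)
    fix i j assume "i < dim_row M" "j < dim_col M"
    then have ij: "i < ?N" "j < ?N" and li: "l i < ?N"
      using l_le[of i] by (simp_all add: M_def)
    have lj: "l j = j" if "l i = j"
      using that l_l[of i] by simp
    have "(N 1 * T) $$ (i, j) = T $$ (i, j) + (if l i \<noteq> i then T $$ (l i, j) else 0)"
      using N_left[OF ij carrier(2), of 1] by simp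
    also have "\<dots> = M $$ (i, j)"
      using ij li lj by (cases "l i = i"; cases "i = j"; cases "l i = j") (simp_all add: T_def M_def)
    finally show "(N 1 * T) $$ (i, j) = M $$ (i, j)" .
  qed (auto simp: N_def T_def M_def)
  \<comment> \<open>Right multiplication by \<open>N (- 1)\<close> subtracts from the first column
    of each block the other columns of that block; this is the amount subtracted in row
    \<open>i\<close>.\<close>
  have block: "(\<Sum>k\<in>{k. k < ?N \<and> l k \<noteq> k \<and> j = l k}. (if l k = l i then 1 else 0) - (if i = k then 1 else 0))
      = (if j = l i then of_nat q - 1 - (if i \<noteq> j then 1 else 0) else (0 :: complex))"
    (is "sum _ ?B = _") if ij: "i < ?N" "j < ?N" for i j
  proof (cases "j = l i")
    case True
    have "?B = {j<..<j + q}"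
    proof (rule Set.set_eqI)
      fix k
      have "k \<in> ?B" if k: "k \<in> {j<..<j + q}"
      proof -
        obtain r where r: "k = j + r" "0 < r" "r < q"
          using k that[of "k - j"] by force
        then have "l k = j"
          by (simp add: True l_def)
        \<comment> \<open>The last block is not truncated, since the size of the matrix is a
          multiple of \<open>q\<close>.\<close>
        moreover have "Suc (i div q) * q \<le> m * q"
          using ij q by (intro mult_right_mono) (simp_all add: Suc_le_eq less_mult_imp_div_less)
        then have "j + q \<le> m * q"
          by (simp add: True l_def)
        ultimately show ?thesis
          using r by simp
      qed
      moreover have "k \<in> {j<..<j + q}" if "k \<in> ?B"
        using that l_le[of k] less_l[of k] by (simp add: less_le)
      ultimately show "k \<in> ?B \<longleftrightarrow> k \<in> {j<..<j + q}" by blast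
    qed
    then have "card ?B = q - 1" by simp
    moreover have "i \<in> ?B \<longleftrightarrow> i \<noteq> j" using ij True by auto
    moreover have "sum (\<lambda>k. (if l k = l i then 1 else 0) - (if i = k then 1 else 0)) ?B
      = (\<Sum>k\<in>?B. 1 - (if i = k then 1 else (0::complex)))"
      using True by (intro sum.cong) auto
    ultimately show ?thesis
      using True q by (simp add: sum_subtractf of_nat_diff)
  next
    case False
    then show ?thesis by (intro trans[OF sum.neutral]) auto
  qed
  have "M * N (- 1) = A"
  proof (rule eq_matI)
    fix i j assume "i < dim_row A" "j < dim_col A"
    then have ij: "i < ?N" "j < ?N" by (auto simp: A)
    have "(M * N (- 1)) $$ (i, j) = (\<Sum>k<?N. M $$ (i, k) * N (- 1) $$ (k, j))"
      using ij by (simp add: M_def N_def scalar_prod_def lessThan_atLeast0)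
    also have "\<dots> = (\<Sum>k<?N. (if k = j then M $$ (i, k) else 0)
        - (if l k \<noteq> k \<and> j = l k then M $$ (i, k) else 0))"
      using ij by (intro sum.cong) (simp_all add: N_def)
    also have "\<dots> = M $$ (i, j) - (\<Sum>k\<in>{k. k < ?N \<and> l k \<noteq> k \<and> j = l k}. M $$ (i, k))"
      using ij by (simp add: sum_subtractf sum.inter_filter[symmetric] lessThan_def)
    also have "(\<Sum>k\<in>{k. k < ?N \<and> l k \<noteq> k \<and> j = l k}. M $$ (i, k))
      = (\<Sum>k\<in>{k. k < ?N \<and> l k \<noteq> k \<and> j = l k}. (if l k = l i then 1 else 0) - (if i = k then 1 else 0))"
      using ij by (intro sum.cong) (auto simp: M_def)
    also note block[OF ij]
    finally show "(M * N (- 1)) $$ (i, j) = A $$ (i, j)"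
      using ij by (auto simp: M_def A l_eq[symmetric])
  qed (auto simp: N_def A M_def)
  with NT have "A = N 1 * T * N (- 1)" by simp
  then have "similar_mat A T"
    using carrier inv[of 1] inv[of "- 1"]
    by (intro similar_matI[of A T "N 1" "N (- 1)" ?N]) simp_all
  then have "char_poly A = char_poly T"
    by (rule char_poly_similar)
  \<comment> \<open>Nonzero entries off the diagonal of \<open>T\<close> occur only at positions
    \<open>(l j, j)\<close>, and \<open>l j\<close> never exceeds \<open>j\<close>.\<close>
  moreover have "upper_triangular T"
    by (auto simp: T_def upper_triangular_def) (metis l_le not_le)
  ultimately have "char_poly A = (\<Prod>a\<leftarrow>diag_mat T. [:- a, 1:])"
    using char_poly_upper_triangular[OF carrier(2)] by simp
  moreover have "diag_mat T = map (\<lambda>i. if i mod q = 0 then of_nat q - 1 else - 1) [0..<?N]"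
    by (auto simp: diag_mat_def T_def l_fix)
  ultimately show ?thesis
    by (simp only: proots_prod_list_linear mset_blocks[OF q])
qed

text \<open>Here \<open>S\<close> indexes the cliques and \<open>R\<close> the vertices within each
  of them. Any enumeration of the vertices may be used, so one that lists clique after clique
  reduces the claim to the block matrix.\<close>

lemma graph_spectrum_cliques:
  fixes f :: "'i \<times> 'j \<Rightarrow> 'a"
  assumes fin: "finite S" "finite R" and "R \<noteq> {}"
    and f: "bij_betw f (S \<times> R) (pverts G)"
    and arcs: "\<And>a b a' b'. a \<in> S \<Longrightarrow> b \<in> R \<Longrightarrow> a' \<in> S \<Longrightarrow> b' \<in> R \<Longrightarrow>
      (f (a, b), f (a', b')) \<in> parcs G \<longleftrightarrow> a = a' \<and> b \<noteq> b'"
  shows "graph_spectrum G = replicate_mset (card S * (card R - 1)) (- 1)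
    + replicate_mset (card S) (of_nat (card R) - 1)"
proof -
  obtain as bs where lists: "set as = S" "distinct as" "set bs = R" "distinct bs"
    using finite_distinct_list fin by metis
  define q m where "q = length bs" and "m = length as"
  have card: "card R = q" "card S = m"
    using lists by (auto simp: q_def m_def distinct_card)
  then have q: "q > 0"
    using fin \<open>R \<noteq> {}\<close> by (auto simp: card_gt_0_iff)
  \<comment> \<open>\<open>List.product\<close> varies its second component fastest, so position
    \<open>k\<close> lies in clique \<open>k div q\<close> at place \<open>k mod q\<close>.\<close>
  define vs where "vs = map f (List.product as bs)"
  have vs: "distinct vs" "set vs = pverts G"
    using lists f by (auto simp: vs_def distinct_map distinct_product bij_betw_def)
  have len: "length vs = m * q"
    by (simp add: vs_def q_def m_def)
  have "adjacency_mat G vs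
      = mat (m * q) (m * q) (\<lambda>(i, j). if i div q = j div q \<and> i \<noteq> j then 1 else 0)"
  proof (rule eq_matI)
    fix i j
    assume "i < dim_row (mat (m * q) (m * q) (\<lambda>(i, j). if i div q = j div q \<and> i \<noteq> j then 1 else 0 :: complex))"
      and "j < dim_col (mat (m * q) (m * q) (\<lambda>(i, j). if i div q = j div q \<and> i \<noteq> j then 1 else 0 :: complex))"
    then have ij: "i < m * q" "j < m * q" by auto
    then have "vs ! k = f (as ! (k div q), bs ! (k mod q))" "k div q < m" "k mod q < q"
      if "k = i \<or> k = j" for k
      using that q by (auto simp: vs_def product_nth q_def m_def less_mult_imp_div_less)
    moreover from this have "(vs ! i, vs ! j) \<in> parcs G \<longleftrightarrow> i div q = j div q \<and> i mod q \<noteq> j mod q"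
      using lists by (auto simp: arcs nth_eq_iff_index_eq q_def m_def)
    moreover have "i = j" if "i div q = j div q" "i mod q = j mod q"
      using that by (metis div_mult_mod_eq)
    ultimately have "(vs ! i, vs ! j) \<in> parcs G \<longleftrightarrow> i div q = j div q \<and> i \<noteq> j"
      by metis
    then show "adjacency_mat G vs $$ (i, j)
      = mat (m * q) (m * q) (\<lambda>(i, j). if i div q = j div q \<and> i \<noteq> j then 1 else 0) $$ (i, j)"
      using ij len by (simp add: adjacency_mat_def)
  qed (simp_all add: adjacency_mat_def len)
  then show ?thesis
    by (simp only: graph_spectrum_eq[OF vs] proots_char_poly_cliques[OF q] card)
qed

section \<open>The matrices U(a, b) and the group they form\<close>

lemma U_mat_index:
  "U_mat \<theta> a b = mat 3 3 (\<lambda>(i, j). if i = j then 1 else if i = 1 \<and> j = 0 then a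
     else if i = 2 \<and> j = 0 then b else if i = 2 \<and> j = 1 then \<theta> a else 0)"
  by (rule eq_matI)
    (auto simp: U_mat_def mat_of_rows_list_def numeral_3_eq_3 less_Suc_eq numeral_2_eq_2)

lemma U_mat_eq_iff: "U_mat \<theta> a b = U_mat \<theta> a' b' \<longleftrightarrow> a = a' \<and> b = b'"
proof
  assume eq: "U_mat \<theta> a b = U_mat \<theta> a' b'"
  have "a = U_mat \<theta> a b $$ (1, 0)" "b = U_mat \<theta> a b $$ (2, 0)" for a b
    by (auto simp: U_mat_index)
  with eq show "a = a' \<and> b = b'" by metis
qed simp

lemma U_mat_mult:
  assumes "\<theta> (a + a') = \<theta> a + \<theta> a'"
  shows "U_mat \<theta> a b * U_mat \<theta> a' b' = U_mat \<theta> (a + a') (b + b' + a' * \<theta> a)"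
  by (rule eq_matI)
    (auto simp: U_mat_index scalar_prod_def numeral_3_eq_3 less_Suc_eq numeral_2_eq_2 assms
      algebra_simps)

lemma U_mat_0: "\<theta> 0 = 0 \<Longrightarrow> U_mat \<theta> 0 0 = 1\<^sub>m 3"
  by (rule eq_matI) (auto simp: U_mat_index)

lemma group_A_group:
  assumes add: "\<And>a b. \<theta> (a + b) = \<theta> a + \<theta> b"
  shows "group (A_group \<theta>)"
proof (rule groupI)
  have 0: "\<theta> 0 = 0" using add[of 0 0] by (metis add_0 add_cancel_right_right)
  have U: "U_mat \<theta> a b \<in> carrier (A_group \<theta>)" for a b
    by (auto simp: A_group_def)
  show "\<one>\<^bsub>A_group \<theta>\<^esub> \<in> carrier (A_group \<theta>)"
    using U[of 0 0] by (simp add: U_mat_0[of \<theta>, OF 0] A_group_def)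
  fix x assume "x \<in> carrier (A_group \<theta>)"
  then obtain a b where x: "x = U_mat \<theta> a b" by (auto simp: A_group_def)
  show "\<one>\<^bsub>A_group \<theta>\<^esub> \<otimes>\<^bsub>A_group \<theta>\<^esub> x = x"
    by (simp add: A_group_def x U_mat_index)
  have "\<theta> (- a) + \<theta> a = 0"
    using add[of "- a" a] 0 by simp
  \<comment> \<open>The left inverse is read off from \<open>U_mat_mult\<close>: its second
    parameter \<open>b''\<close> must satisfy
    \<open>b'' + b + a * \<theta> (- a) = 0\<close>.\<close>
  then have "U_mat \<theta> (- a) (- b - a * \<theta> (- a)) \<otimes>\<^bsub>A_group \<theta>\<^esub> x = \<one>\<^bsub>A_group \<theta>\<^esub>"
    by (simp add: A_group_def x U_mat_mult 0 U_mat_0[of \<theta>, OF 0])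
  then show "\<exists>y\<in>carrier (A_group \<theta>). y \<otimes>\<^bsub>A_group \<theta>\<^esub> x = \<one>\<^bsub>A_group \<theta>\<^esub>"
    using U by blast
qed (auto simp: A_group_def U_mat_mult add U_mat_eq_iff algebra_simps)

section \<open>Commutation, centre and spectrum in characteristic 2\<close>

lemma frobenius_add:
  assumes "(2 :: 'a :: field) = 0"
  shows "frobenius (a + b) = frobenius a + frobenius (b :: 'a)"
  by (simp add: frobenius_def power2_sum assms)

text \<open>The two products agree except possibly in the lower left entry, where equality amounts
  to \<open>a * a' * (a - a') = 0\<close>.\<close>

lemma U_mat_frobenius_commute_iff:
  assumes "(2 :: 'a :: field) = 0"
  shows "U_mat frobenius a b * U_mat frobenius a' b' = U_mat frobenius a' b' * U_mat frobenius a (b :: 'a)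
    \<longleftrightarrow> a = 0 \<or> a' = 0 \<or> a = a'"
  by (simp add: U_mat_mult frobenius_add[OF assms] U_mat_eq_iff add_ac)
    (auto simp: frobenius_def power2_eq_square)

lemma centre_A_group_frobenius:
  assumes "(2 :: 'a :: {field, finite}) = 0" and "CARD('a) > 2"
  shows "centre (A_group frobenius) = {U_mat frobenius 0 b | b :: 'a. True}"
proof -
  \<comment> \<open>For \<open>a\<close> nonzero, such a \<open>c\<close> yields elements U(c, b')
    that do not commute with U(a, b), so U(a, b) is not central.\<close>
  have "\<exists>c. c \<noteq> 0 \<and> c \<noteq> a" for a :: 'a
  proof (rule ccontr)
    assume "\<nexists>c. c \<noteq> 0 \<and> c \<noteq> a"
    then have "card (UNIV :: 'a set) \<le> card {0, a}"
      by (intro card_mono) auto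
    also have "\<dots> \<le> 2" by (simp add: card_insert_if)
    finally show False using assms(2) by simp
  qed
  then have non_central: "a = 0"
    if "\<forall>a' b'. U_mat frobenius a b * U_mat frobenius a' b' = U_mat frobenius a' b' * U_mat frobenius a b"
    for a b :: 'a
    using that by (metis U_mat_frobenius_commute_iff[OF assms(1)])
  show ?thesis
  proof (intro equalityI subsetI)
    fix x :: "'a mat"
    assume x: "x \<in> centre (A_group frobenius)"
    then obtain a b where ab: "x = U_mat frobenius a b"
      by (auto simp: centre_def A_group_def)
    with x have "a = 0"
      by (intro non_central[of a b]) (auto simp: centre_def A_group_def)
    with ab show "x \<in> {U_mat frobenius 0 b | b. True}" by blast
  next
    fix x :: "'a mat"
    assume "x \<in> {U_mat frobenius 0 b | b. True}"
    then show "x \<in> centre (A_group frobenius)"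
      by (auto simp: centre_def A_group_def U_mat_frobenius_commute_iff[OF assms(1)])
  qed
qed

theorem proposition2p8:
  fixes n :: nat
  assumes "n \<ge> 2"
    and "CARD('f) = 2 ^ n"
  shows "group (A_group (frobenius :: 'f :: {field, finite} \<Rightarrow> 'f)) \<and>
    (\<forall>a b a' b' :: 'f.
       U_mat frobenius a b \<otimes>\<^bsub>A_group frobenius\<^esub> U_mat frobenius a' b'
         = U_mat frobenius (a + a') (b + b' + a' * frobenius a)) \<and>
    graph_spectrum (commuting_graph (A_group (frobenius :: 'f \<Rightarrow> 'f)))
      = replicate_mset ((2 ^ n - 1)\<^sup>2) (- 1) + replicate_mset (2 ^ n - 1) (2 ^ n - 1)"
proof -
  \<comment> \<open>The characteristic divides the order \<open>2 ^ n\<close> of the field, and a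
    field has no nonzero nilpotent elements.\<close>
  have "(2 :: 'f) ^ n = 0"
    using CHAR_dvd_CARD[where 'a = 'f] by (simp add: assms(2) flip: of_nat_eq_0_iff_char_dvd)
  then have 2: "(2 :: 'f) = 0" by simp
  have "(2 :: nat) ^ 2 \<le> 2 ^ n"
    using assms(1) by (intro power_increasing) auto
  then have card: "CARD('f) > 2" using assms(2) by simp
  let ?A = "A_group (frobenius :: 'f \<Rightarrow> 'f)"
  let ?f = "\<lambda>(a, b). U_mat frobenius a (b :: 'f)"
  have verts: "carrier ?A - centre ?A = ?f ` ((UNIV - {0}) \<times> UNIV)"
    unfolding centre_A_group_frobenius[OF 2 card] by (auto simp: A_group_def U_mat_eq_iff)
  have "graph_spectrum (commuting_graph ?A)
      = replicate_mset (card (UNIV - {0 :: 'f}) * (CARD('f) - 1)) (- 1)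
        + replicate_mset (card (UNIV - {0 :: 'f})) (of_nat CARD('f) - 1)"
  proof (rule graph_spectrum_cliques[where f = ?f])
    show "bij_betw ?f ((UNIV - {0}) \<times> UNIV) (pverts (commuting_graph ?A))"
      by (auto simp: commuting_graph_def verts bij_betw_def inj_on_def U_mat_eq_iff)
  next
    fix a b a' b' :: 'f
    assume "a \<in> UNIV - {0}" "a' \<in> UNIV - {0}"
    then show "(?f (a, b), ?f (a', b')) \<in> parcs (commuting_graph ?A) \<longleftrightarrow> a = a' \<and> b \<noteq> b'"
      by (auto simp: commuting_graph_def verts U_mat_eq_iff)
        (auto simp: A_group_def U_mat_frobenius_commute_iff[OF 2])
  qed auto
  \<comment> \<open>There are \<open>2 ^ n - 1\<close> cliques with \<open>2 ^ n\<close> vertices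
    each, and every clique contributes \<open>2 ^ n - 1\<close> copies of -1; hence the
    square.\<close>
  then have "graph_spectrum (commuting_graph ?A)
      = replicate_mset ((2 ^ n - 1)\<^sup>2) (- 1) + replicate_mset (2 ^ n - 1) (2 ^ n - 1)"
    by (simp add: assms(2) card_Diff_singleton power2_eq_square)
  then show ?thesis
    using group_A_group[of "frobenius :: 'f \<Rightarrow> 'f"] frobenius_add[OF 2]
    by (simp add: A_group_def U_mat_mult)
qed

end
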